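(* Let $M\in\mathbb{C}^{p\times p}$ be nonsingular and let $\mathcal{A},\mathcal{B}\in\mathbb{C}^{m\times m\times p}$ have tubal indices $k_1\ge 1$ and $k_2\ge 1$, respectively. If $\mathcal{A}*_M\mathcal{B}=\mathcal{B}*_M\mathcal{A}=\mathcal{O}$, then $(\mathcal{A}+\mathcal{B})^{\mathrm D}=\mathcal{A}^{\mathrm D}+\mathcal{B}^{\mathrm D}$ and $(\mathcal{A}-\mathcal{B})^{\mathrm D}=\mathcal{A}^{\mathrm D}-\mathcal{B}^{\mathrm D}$.
   Context: Transform: for $\mathcal{A}\in\mathbb{C}^{m\times n\times p}$, $\tilde{\mathcal{A}}=\mathcal{A}\times_3 M\in\mathbb{C}^{m\times n\times p}$ is given by $(\tilde{\mathcal{A}})_{ijk}=\sum_{s=1}^p(\mathcal{A})_{ijs}M_{ks}$, and $\tilde{\mathcal{A}}^{(i)}=\tilde{\mathcal{A}}(:,:,i)$ is its $i$th frontal slice. Since $M$ is nonsingular, $\mathcal{A}\mapsto\tilde{\mathcal{A}}$ is a bijection. $M$-product: for $\mathcal{A}\in\mathbb{C}^{m\times n\times p}$, $\mathcal{B}\in\mathbb{C}^{n\times l\times p}$, $\mathcal{A}*_M\mathcal{B}$ is the unique $\mathcal{C}\in\mathbb{C}^{m\times l\times p}$ with $\tilde{\mathcal{C}}^{(i)}=\tilde{\mathcal{A}}^{(i)}\tilde{\mathcal{B}}^{(i)}$, $i=1,\dots,p$. The identity tensor $\mathcal{I}$ has $\tilde{\mathcal{I}}^{(i)}=I_m$ for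 all $i$; $\mathcal{O}$ is the zero tensor; powers are taken with respect to $*_M$, with $\mathcal{A}^0=\mathcal{I}$. Tubal index of $\mathcal{A}\in\mathbb{C}^{m\times m\times p}$: $k=\max_{1\le i\le p}\mathrm{ind}(\tilde{\mathcal{A}}^{(i)})$, where $\mathrm{ind}(A)$ is the least integer $k\ge 0$ with $\mathrm{rank}(A^k)=\mathrm{rank}(A^{k+1})$. Drazin inverse: for $\mathcal{A}\in\mathbb{C}^{m\times m\times p}$ of tubal index $k$, $\mathcal{A}^{\mathrm D}$ is the unique $\mathcal{X}\in\mathbb{C}^{m\times m\times p}$ with $\mathcal{X}*_M\mathcal{A}*_M\mathcal{X}=\mathcal{X}$, $\mathcal{A}*_M\mathcal{X}=\mathcal{X}*_M\mathcal{A}$ and $\mathcal{X}*_M\mathcal{A}^{k+1}=\mathcal{A}^k$. *)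

theory Defs
  imports "HOL-Analysis.Analysis"
begin

text \<open>
  A tensor in $C^{m \times n \times p}$ is an element of \<^typ>\<open>complex^'p^'n^'m\<close>, so that its
  \<open>(i, j, k)\<close> entry is \<open>A $ i $ j $ k\<close>.  Addition, subtraction and \<open>0\<close> are the library's
  (componentwise) ones.  The library's \<open>*\<close>, \<open>1\<close> and \<open>^\<close> on vectors are componentwise as well and
  are therefore not used for matrices or tensors.
\<close>

definition mode3_prod :: "complex^'p^'n^'m \<Rightarrow> complex^'p^'p \<Rightarrow> complex^'p^'n^'m" (infixl "\<times>\<^sub>3" 70)
  where "A \<times>\<^sub>3 M = (\<chi> i j k. \<Sum>s\<in>UNIV. A $ i $ j $ s * M $ k $ s)"

definition frontal_slice :: "complex^'p^'n^'m \<Rightarrow> 'p \<Rightarrow> complex^'n^'m"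
  where "frontal_slice A k = (\<chi> i j. A $ i $ j $ k)"

definition tslice :: "complex^'p^'p \<Rightarrow> complex^'p^'n^'m \<Rightarrow> 'p \<Rightarrow> complex^'n^'m"
  where "tslice M A k = frontal_slice (A \<times>\<^sub>3 M) k"

text \<open>
  For nonsingular \<open>M\<close> the transformed frontal slices can be prescribed arbitrarily and determine the
  tensor; this justifies the definite descriptions in \<open>M_prod\<close> and \<open>M_id\<close> below.
\<close>

lemma ex1_tslice:
  fixes M :: "complex^'p^'p" and F :: "'p \<Rightarrow> complex^'n^'m"
  assumes "invertible M"
  shows "\<exists>!C. \<forall>k. tslice M C k = F k"
proof -
  obtain N where N: "M ** N = mat 1" "N ** M = mat 1"
    using assms unfolding invertible_def by blast
  have tubes: "(\<forall>k. tslice M C k = F k) \<longleftrightarrow> (\<forall>i j. M *v (C $ i $ j) = (\<chi> k. F k $ i $ j))"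
    for C :: "complex^'p^'n^'m"
    by (auto simp: tslice_def frontal_slice_def mode3_prod_def matrix_vector_mult_def vec_eq_iff
        mult.commute)
  have solve: "M *v x = y \<longleftrightarrow> x = N *v y" for x y
    by (metis N matrix_vector_mul_assoc matrix_vector_mul_lid)
  show ?thesis
    unfolding tubes solve
    by (rule ex1I[of _ "\<chi> i j. N *v (\<chi> k. F k $ i $ j)"]) (simp_all add: vec_eq_iff)
qed

definition M_prod :: "complex^'p^'p \<Rightarrow> complex^'p^'n^'m \<Rightarrow> complex^'p^'l^'n \<Rightarrow> complex^'p^'l^'m"
  where "M_prod M A B = (THE C. \<forall>k. tslice M C k = tslice M A k ** tslice M B k)"

definition M_id :: "complex^'p^'p \<Rightarrow> complex^'p^'m^'m"
  where "M_id M = (THE I. \<forall>k. tslice M I k = mat 1)"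

primrec M_pow :: "complex^'p^'p \<Rightarrow> complex^'p^'m^'m \<Rightarrow> nat \<Rightarrow> complex^'p^'m^'m"
  where
    "M_pow M A 0 = M_id M"
  | "M_pow M A (Suc r) = M_prod M (M_pow M A r) A"

primrec mat_pow :: "complex^'m^'m \<Rightarrow> nat \<Rightarrow> complex^'m^'m"
  where
    "mat_pow A 0 = mat 1"
  | "mat_pow A (Suc r) = mat_pow A r ** A"

definition mat_index :: "complex^'m^'m \<Rightarrow> nat"
  where "mat_index A = (LEAST k. rank (mat_pow A k) = rank (mat_pow A (k + 1)))"

definition tubal_index :: "complex^'p^'p \<Rightarrow> complex^'p^'m^'m \<Rightarrow> nat"
  where "tubal_index M A = Max (range (\<lambda>i. mat_index (tslice M A i)))"

definition is_drazin_inverse :: "complex^'p^'p \<Rightarrow> complex^'p^'m^'m \<Rightarrow> complex^'p^'m^'m \<Rightarrow> bool"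
  where "is_drazin_inverse M A X \<longleftrightarrow>
    M_prod M (M_prod M X A) X = X \<and>
    M_prod M A X = M_prod M X A \<and>
    M_prod M X (M_pow M A (tubal_index M A + 1)) = M_pow M A (tubal_index M A)"

definition drazin_inverse :: "complex^'p^'p \<Rightarrow> complex^'p^'m^'m \<Rightarrow> complex^'p^'m^'m"
  where "drazin_inverse M A = (THE X. is_drazin_inverse M A X)"

end

theory Submission
  imports Defs
begin

text \<open>
  The transformed frontal slices turn the $M$-product into $p$ independent matrix products, so the
  whole question lives in the algebra of square complex matrices.  There, if \<open>X\<close> and \<open>Y\<close> are Drazin
  inverses of \<open>A\<close> and \<open>B\<close> and \<open>A ** B = B ** A = 0\<close>, all mixed products of \<open>A\<close> or \<open>X\<close> with \<open>B\<close> or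
  \<open>Y\<close> vanish, because \<open>X = A ** X ** X = X ** X ** A\<close> and likewise for \<open>Y\<close>.  The defining equations
  of \<open>X\<close> and \<open>Y\<close> can therefore be added term by term.  The statement for \<open>A - B\<close> is the one for
  \<open>A + (- B)\<close>, since \<open>- Y\<close> is a Drazin inverse of \<open>- B\<close>.

  Two points keep this from being immediate.  The tubal index of \<open>A + B\<close> is not visible from those
  of \<open>A\<close> and \<open>B\<close>, and it is common to all slices whereas each slice has an index of its own.  Both
  difficulties disappear once the index equation \<open>X ** A^(k+1) = A^k\<close> is only required for some
  exponent: it then holds for every exponent that is at least the index
  (\<open>mat_drazin_index_equation\<close>).  Moreover, a definite description says nothing unless exactly one
  object satisfies it, so existence and uniqueness of Drazin inverses of matrices are needed
  (\<open>mat_drazin_exists\<close>, \<open>mat_drazin_unique\<close>).  Existence rests on the rank sequence of the powers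
  becoming stationary, both for \<open>A\<close> and for its transpose.
\<close>

section \<open>Powers of a matrix and their row spaces\<close>

lemma mat_pow_add: "mat_pow A (a + b) = mat_pow A a ** mat_pow A b"
  by (induction b) (simp_all add: matrix_mul_assoc)

lemma mat_pow_commute: "mat_pow A a ** mat_pow A b = mat_pow A b ** mat_pow A a"
  by (metis mat_pow_add add.commute)

lemma mat_pow_Suc_left: "mat_pow A (Suc n) = A ** mat_pow A n"
  using mat_pow_commute[of A 1 n] by simp

lemma mat_pow_transpose: "mat_pow (transpose A) n = transpose (mat_pow A n)"
proof (induction n)
  case (Suc n)
  then show ?case
    by (metis mat_pow.simps(2) mat_pow_Suc_left matrix_transpose_mul)
qed (simp add: transpose_mat)

lemma mat_pow_commutes_with:
  assumes "A ** X = X ** A"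
  shows "mat_pow A n ** X = X ** mat_pow A n"
  using assms by (induction n) (auto simp: matrix_mul_assoc, metis matrix_mul_assoc)

lemma row_space_eq_range:
  fixes B :: "complex^'n^'m"
  shows "vec.span (rows B) = range (\<lambda>x. x v* B)"
proof
  have "row i B = axis i 1 v* B" for i
    by (simp add: vec_eq_iff row_def vector_matrix_mult_def axis_def
        if_distrib[of "\<lambda>t. t * _"] cong: if_cong)
  then have "rows B \<subseteq> range (\<lambda>x. x v* B)"
    by (auto simp: rows_def)
  moreover have "vec.subspace (range (\<lambda>x. x v* B))"
  proof (rule vec.subspaceI)
    show "0 \<in> range (\<lambda>x. x v* B)"
      by (rule range_eqI[of _ _ 0]) simp
    show "u + v \<in> range (\<lambda>x. x v* B)"
      if "u \<in> range (\<lambda>x. x v* B)" "v \<in> range (\<lambda>x. x v* B)" for u v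
      using that by (auto simp flip: vector_matrix_left_distrib)
    show "c *s u \<in> range (\<lambda>x. x v* B)" if "u \<in> range (\<lambda>x. x v* B)" for c u
    proof -
      from that obtain x where "u = x v* B" by blast
      then have "c *s u = (c *s x) v* B"
        by (simp add: vec_eq_iff vector_matrix_mult_def sum_distrib_left mult.assoc)
      then show ?thesis by blast
    qed
  qed
  ultimately show "vec.span (rows B) \<subseteq> range (\<lambda>x. x v* B)"
    by (rule vec.span_minimal)
  show "range (\<lambda>x. x v* B) \<subseteq> vec.span (rows B)"
    using matrix_vector_mult_in_columnspace_gen[of "transpose B"]
    by (auto simp: columns_transpose)
qed

lemma row_space_mult_subset:
  fixes A :: "complex^'n^'m" and B :: "complex^'l^'n"
  shows "vec.span (rows (A ** B)) \<subseteq> vec.span (rows B)"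
  by (auto simp: row_space_eq_range simp flip: vector_matrix_mul_assoc)

lemma rank_mult_le:
  fixes A :: "complex^'n^'m" and B :: "complex^'l^'n"
  shows "rank (A ** B) \<le> rank B"
  unfolding row_rank_def_gen
  by (metis row_space_mult_subset vec.dim_span vec.dim_subset)

text \<open>
  The row space of \<open>A ** B\<close> lies in that of \<open>B\<close>.  If the dimensions agree, the two are equal, so
  every row of \<open>B\<close> is a combination of the rows of \<open>A ** B\<close>.
\<close>

lemma rank_mult_eq_imp_left_factor:
  fixes A :: "complex^'n^'m" and B :: "complex^'l^'n"
  assumes "rank (A ** B) = rank B"
  obtains V where "B = V ** (A ** B)"
proof -
  have "vec.span (rows B) = vec.span (rows (A ** B))"
    using row_space_mult_subset[of A B] assms
    by (metis order_refl row_rank_def_gen vec.dim_span vec.subspace_span vec.subspace_dim_equal)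
  moreover have "row i B \<in> vec.span (rows B)" for i
    by (rule vec.span_base) (auto simp: rows_def)
  ultimately have "\<exists>x. row i B = x v* (A ** B)" for i
    unfolding row_space_eq_range[of "A ** B"] by blast
  then obtain x where x: "\<And>i. row i B = x i v* (A ** B)"
    by metis
  have "B $ i $ j = ((\<chi> i. x i) ** (A ** B)) $ i $ j" for i j
    using arg_cong[OF x[of i], of "\<lambda>v. v $ j"]
    by (simp add: row_def vector_matrix_mult_def matrix_matrix_mult_def[of "\<chi> i. x i"]
        mult.commute)
  then show thesis
    by (intro that[of "\<chi> i. x i"]) (simp add: vec_eq_iff)
qed

section \<open>The index of a matrix\<close>

text \<open>
  A non-increasing sequence of natural numbers cannot decrease at every step, so the minimum in the
  definition of the index is taken over a nonempty set.
\<close>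

lemma rank_mat_pow_mat_index:
  "rank (mat_pow A (mat_index A)) = rank (mat_pow A (mat_index A + 1))"
proof -
  have le: "rank (mat_pow A (k + 1)) \<le> rank (mat_pow A k)" for k
    using rank_mult_le[of A "mat_pow A k"] by (simp add: mat_pow_Suc_left del: mat_pow.simps)
  have "\<exists>k. rank (mat_pow A k) = rank (mat_pow A (k + 1))"
  proof (rule ccontr)
    assume "\<nexists>k. rank (mat_pow A k) = rank (mat_pow A (k + 1))"
    then have less: "rank (mat_pow A (k + 1)) < rank (mat_pow A k)" for k
      using le[of k] by (metis le_neq_implies_less)
    have "rank (mat_pow A k) + k \<le> rank (mat_pow A 0)" for k
    proof (induction k)
      case (Suc k)
      then show ?case using less[of k] by simp
    qed simp
    from this[of "Suc (rank (mat_pow A 0))"] show False by simp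
  qed
  then show ?thesis
    unfolding mat_index_def by (rule LeastI_ex)
qed

text \<open>
  From the index on, a power is a left multiple of every later power: the left factor that raises
  the exponent from the index by one can be applied repeatedly, and multiplication on the right by
  powers of \<open>A\<close> moves the starting exponent up.
\<close>

lemma mat_pow_left_factor:
  assumes "mat_index A \<le> k"
  obtains V where "mat_pow A k = V ** mat_pow A (k + n)"
proof -
  define j where "j = mat_index A"
  have "rank (A ** mat_pow A j) = rank (mat_pow A j)"
    using rank_mat_pow_mat_index[of A] unfolding j_def[symmetric]
    by (simp add: mat_pow_Suc_left del: mat_pow.simps)
  then obtain W where "mat_pow A j = W ** (A ** mat_pow A j)"
    by (rule rank_mult_eq_imp_left_factor)
  then have base: "mat_pow A j = W ** mat_pow A (j + 1)"
    by (simp add: mat_pow_Suc_left del: mat_pow.simps)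
  have step: "mat_pow A l = W ** mat_pow A (l + 1)" if "j \<le> l" for l
  proof -
    have "mat_pow A l = mat_pow A j ** mat_pow A (l - j)"
      using that by (simp flip: mat_pow_add)
    also have "\<dots> = W ** (mat_pow A (j + 1) ** mat_pow A (l - j))"
      by (subst base) (simp add: matrix_mul_assoc)
    also have "\<dots> = W ** mat_pow A (l + 1)"
      using that by (simp del: mat_pow.simps flip: mat_pow_add)
    finally show ?thesis .
  qed
  have "\<exists>V. mat_pow A k = V ** mat_pow A (k + n)"
  proof (induction n)
    case 0
    show ?case by (rule exI[of _ "mat 1"]) simp
  next
    case (Suc n)
    then obtain V where "mat_pow A k = V ** mat_pow A (k + n)" ..
    also have "\<dots> = V ** (W ** mat_pow A (k + Suc n))"
      using step[of "k + n"] assms unfolding j_def by simp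
    finally show ?case by (auto simp: matrix_mul_assoc)
  qed
  then show thesis using that by blast
qed

section \<open>Drazin inverses of matrices\<close>

text \<open>
  Asking for the index equation at some unspecified exponent makes the notion independent of the
  index, and hence stable under sums and under passing from a tensor to its slices.
\<close>

definition mat_drazin :: "complex^'m^'m \<Rightarrow> complex^'m^'m \<Rightarrow> bool"
  where "mat_drazin A X \<longleftrightarrow>
    X ** A ** X = X \<and> A ** X = X ** A \<and> (\<exists>n. X ** mat_pow A (n + 1) = mat_pow A n)"

lemma index_equation_mono:
  assumes "X ** mat_pow A (n + 1) = mat_pow A n" and "n \<le> k"
  shows "X ** mat_pow A (k + 1) = mat_pow A k"
proof -
  have "X ** mat_pow A (k + 1) = X ** mat_pow A (n + 1) ** mat_pow A (k - n)"
    using assms(2) by (simp del: mat_pow.simps flip: mat_pow_add matrix_mul_assoc)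
  then show ?thesis
    using assms by (simp del: mat_pow.simps flip: mat_pow_add)
qed

text \<open>
  The exponent can be lowered to the index as well: \<open>A^k = V ** A^(k+n)\<close>, and \<open>X\<close>, which commutes
  with \<open>A\<close>, acts as it should on the right-hand side when \<open>n\<close> is large.
\<close>

lemma mat_drazin_index_equation:
  assumes "mat_drazin A X" and "mat_index A \<le> k"
  shows "X ** mat_pow A (k + 1) = mat_pow A k"
proof -
  obtain n where n: "X ** mat_pow A (n + 1) = mat_pow A n" and comm: "A ** X = X ** A"
    using assms(1) unfolding mat_drazin_def by blast
  obtain V where V: "mat_pow A k = V ** mat_pow A (k + n)"
    using mat_pow_left_factor[OF assms(2)] .
  have "X ** mat_pow A (k + 1) = mat_pow A k ** A ** X"
    by (metis Suc_eq_plus1 comm mat_pow.simps(2) mat_pow_commutes_with)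
  also have "\<dots> = V ** (mat_pow A (k + n + 1) ** X)"
    by (subst V) (simp add: matrix_mul_assoc)
  also have "\<dots> = V ** (X ** mat_pow A (k + n + 1))"
    by (metis comm mat_pow_commutes_with)
  also have "\<dots> = V ** mat_pow A (k + n)"
    using index_equation_mono[OF n, of "k + n"] by simp
  finally show ?thesis using V by simp
qed

text \<open>
  The idempotent \<open>X ** A\<close> contains arbitrarily high powers of \<open>A\<close> as a factor, in particular powers
  beyond the index, on which every Drazin inverse of \<open>A\<close> acts in the same way.
\<close>

lemma mat_drazin_powers:
  assumes "X ** A ** X = X" and "A ** X = X ** A"
  shows "X ** A = mat_pow X (Suc n) ** mat_pow A (Suc n)"
proof (induction n)
  case (Suc n)
  have "mat_pow X (Suc (Suc n)) ** mat_pow A (Suc (Suc n))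
      = X ** (mat_pow X (Suc n) ** mat_pow A (Suc n)) ** A"
    unfolding mat_pow_Suc_left[of X "Suc n"] mat_pow.simps(2)[of A "Suc n"]
    by (simp only: matrix_mul_assoc)
  also have "\<dots> = X ** (X ** A) ** A"
    by (simp only: Suc.IH)
  also have "\<dots> = X ** A"
    using assms by (simp add: matrix_mul_assoc) (metis matrix_mul_assoc)
  finally show ?case by simp
qed simp

text \<open>
  For two Drazin inverses \<open>X\<close> and \<open>Y\<close> the idempotents \<open>X ** A\<close> and \<open>Y ** A\<close> coincide, as each of
  them equals \<open>X ** A ** (Y ** A)\<close>; and \<open>X = (X ** A) ** X\<close> can then be turned into \<open>Y\<close>.
\<close>

lemma mat_drazin_unique:
  assumes X: "mat_drazin A X" and Y: "mat_drazin A Y"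
  shows "X = Y"
proof -
  note dX = X[unfolded mat_drazin_def] and dY = Y[unfolded mat_drazin_def]
  define P where "P = mat_pow A (Suc (mat_index A))"
  have PX: "X ** A ** P = P" and PY: "Y ** A ** P = P"
    using mat_drazin_index_equation[OF X, of "Suc (mat_index A)"]
      mat_drazin_index_equation[OF Y, of "Suc (mat_index A)"]
    by (simp_all add: P_def mat_pow_Suc_left matrix_mul_assoc del: mat_pow.simps)
  obtain U where U: "X ** A = U ** P"
    using mat_drazin_powers dX unfolding P_def by blast
  obtain W where W: "Y ** A = P ** W"
    using mat_drazin_powers[of Y A "mat_index A"] dY mat_pow_commutes_with
    unfolding P_def by metis
  have "X ** A = U ** (Y ** A ** P)"
    using U PY by simp
  also have "Y ** A ** P = P ** (Y ** A)"
    using dY mat_pow_commutes_with[of A "Y ** A"] unfolding P_def by (metis matrix_mul_assoc)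
  also have "U ** (P ** (Y ** A)) = X ** A ** (P ** W)"
    using U W by (simp add: matrix_mul_assoc)
  also have "\<dots> = Y ** A"
    using PX W by (simp add: matrix_mul_assoc)
  finally have eq: "X ** A = Y ** A" .
  have "X = Y ** (A ** X)"
    using dX eq by (metis matrix_mul_assoc)
  also have "\<dots> = Y ** (A ** Y)"
    using dX dY eq by metis
  finally show ?thesis
    using dY by (metis matrix_mul_assoc)
qed

text \<open>
  For a large exponent \<open>k\<close>, the power \<open>A^k\<close> equals both \<open>V ** A^(2k+1)\<close> and \<open>A^(2k+1) ** W\<close>, the
  second by transposition.  Since \<open>V\<close> and \<open>W\<close> stand in for the \<open>(k+1)\<close>-st power of the inverse, the
  candidate is \<open>V ** A^k = A^k ** W\<close>; having both forms is what makes it commute with \<open>A\<close>.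
\<close>

lemma mat_drazin_exists: "\<exists>X. mat_drazin A X"
proof -
  define k where "k = max (mat_index A) (mat_index (transpose A))"
  define p where "p = mat_pow A k"
  define q where "q = mat_pow A (k + 1)"
  have pq: "p ** q = q ** p" and q: "q = A ** p" "q = p ** A"
    unfolding p_def q_def
    by (rule mat_pow_commute) (simp_all add: mat_pow_Suc_left[symmetric])
  have sum: "mat_pow A (k + (k + 1)) = p ** q"
    unfolding p_def q_def by (rule mat_pow_add)
  obtain V where "mat_pow A k = V ** mat_pow A (k + (k + 1))"
    using mat_pow_left_factor[of A k] unfolding k_def by (metis max.cobounded1)
  then have V: "p = V ** q ** p"
    using sum pq p_def by (metis matrix_mul_assoc)
  obtain U where "mat_pow (transpose A) k = U ** mat_pow (transpose A) (k + (k + 1))"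
    using mat_pow_left_factor[of "transpose A" k] unfolding k_def by (metis max.cobounded2)
  then have "transpose (transpose p) = transpose (U ** transpose (p ** q))"
    unfolding mat_pow_transpose sum p_def by simp
  then have W: "p = p ** q ** transpose U"
    by (simp add: matrix_transpose_mul)
  define W where "W = transpose U"
  define X where "X = V ** p"
  have X': "X = p ** W"
  proof -
    have "X = V ** (q ** p ** W)"
      unfolding X_def W_def using W pq by metis
    then show ?thesis using V by (metis matrix_mul_assoc)
  qed
  have "A ** X = X ** A"
  proof -
    have "q = V ** q ** q"
      using V q(2) by (metis matrix_mul_assoc)
    then have "q ** W = V ** q ** (q ** W)"
      by (metis matrix_mul_assoc)
    also have "\<dots> = V ** (A ** (p ** q ** W))"
      using q pq by (metis matrix_mul_assoc)
    also have "\<dots> = V ** q"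
      using W q unfolding W_def by metis
    finally show ?thesis
      using q unfolding X' by (metis X_def X' matrix_mul_assoc)
  qed
  moreover have "X ** A ** X = X"
  proof -
    have "X ** A ** X = V ** q ** (p ** W)"
      using q X' X_def by (metis matrix_mul_assoc)
    then show ?thesis using V X' by (metis matrix_mul_assoc)
  qed
  moreover have "X ** mat_pow A (k + 1) = mat_pow A k"
    unfolding p_def[symmetric] q_def[symmetric] X_def using V pq by (metis matrix_mul_assoc)
  ultimately show ?thesis
    unfolding mat_drazin_def by blast
qed

section \<open>Sums of Drazin inverses of matrices\<close>

lemma matrix_mult_add_left: "(A + B) ** C = A ** C + B ** C"
  for A B :: "complex^'n^'m" and C :: "complex^'l^'n"
  by (simp add: vec_eq_iff matrix_matrix_mult_def distrib_right sum.distrib)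

lemma matrix_mult_minus_left: "(- A) ** B = - (A ** B)"
  for A :: "complex^'n^'m" and B :: "complex^'l^'n"
  by (simp add: vec_eq_iff matrix_matrix_mult_def sum_negf)

lemma matrix_mult_minus_right: "A ** (- B) = - (A ** B)"
  for A :: "complex^'n^'m" and B :: "complex^'l^'n"
  by (simp add: vec_eq_iff matrix_matrix_mult_def sum_negf)

lemma mat_pow_minus: "mat_pow (- A) n = (if even n then mat_pow A n else - mat_pow A n)"
  by (induction n) (auto simp: matrix_mult_minus_left matrix_mult_minus_right)

lemma mat_drazin_minus:
  assumes "mat_drazin A X"
  shows "mat_drazin (- A) (- X)"
proof -
  obtain n where "X ** mat_pow A (n + 1) = mat_pow A n"
    using assms unfolding mat_drazin_def by blast
  then have "(- X) ** mat_pow (- A) (n + 1) = mat_pow (- A) n"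
    unfolding mat_pow_minus by (simp add: matrix_mult_minus_left matrix_mult_minus_right)
  then show ?thesis
    using assms unfolding mat_drazin_def
    by (auto simp: matrix_mult_minus_left matrix_mult_minus_right)
qed

lemma mat_pow_add_orthogonal:
  assumes "A ** B = 0" and "B ** A = 0"
  shows "mat_pow (A + B) (Suc n) = mat_pow A (Suc n) + mat_pow B (Suc n)"
proof (induction n)
  case (Suc n)
  have "mat_pow A (Suc n) ** B = 0" "mat_pow B (Suc n) ** A = 0"
    using assms by (simp_all flip: matrix_mul_assoc)
  then show ?case
    unfolding mat_pow.simps(2)[of _ "Suc n"] Suc.IH
    by (simp add: matrix_add_ldistrib matrix_mult_add_left del: mat_pow.simps)
qed simp

lemma mat_drazin_mult_zero:
  assumes "mat_drazin A X" and "A ** B = 0" and "B ** A = 0"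
  shows "X ** B = 0" and "B ** X = 0"
proof -
  have "X = X ** X ** A" "X = A ** X ** X"
    using assms(1) unfolding mat_drazin_def by (metis matrix_mul_assoc)+
  then show "X ** B = 0" "B ** X = 0"
    using assms(2,3) by (metis matrix_mul_assoc times0_left times0_right)+
qed

lemma mat_drazin_add:
  assumes X: "mat_drazin A X" and Y: "mat_drazin B Y"
    and AB: "A ** B = 0" and BA: "B ** A = 0"
  shows "mat_drazin (A + B) (X + Y)"
proof -
  note dX = X[unfolded mat_drazin_def] and dY = Y[unfolded mat_drazin_def]
  note XB = mat_drazin_mult_zero[OF X AB BA] and YA = mat_drazin_mult_zero[OF Y BA AB]
  note XY = mat_drazin_mult_zero[OF Y XB(2) XB(1)]
  have prod: "(X + Y) ** (A + B) = X ** A + Y ** B" "(A + B) ** (X + Y) = X ** A + Y ** B"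
    using XB YA dX dY by (simp_all add: matrix_add_ldistrib matrix_mult_add_left)
  have "X ** A ** Y = 0" "Y ** B ** X = 0"
    using XB YA by (simp_all flip: matrix_mul_assoc)
  then have 1: "(X + Y) ** (A + B) ** (X + Y) = X + Y"
    unfolding prod using dX dY by (simp add: matrix_add_ldistrib matrix_mult_add_left)
  \<comment> \<open>The powers of \<open>A + B\<close> split only for positive exponents, so the exponent is a successor.\<close>
  define n where "n = Suc (max (mat_index A) (mat_index B))"
  have pow: "mat_pow (A + B) n = mat_pow A n + mat_pow B n"
    "mat_pow (A + B) (n + 1) = mat_pow A (n + 1) + mat_pow B (n + 1)"
    using mat_pow_add_orthogonal[OF AB BA] unfolding n_def by (simp_all del: mat_pow.simps)
  have "X ** mat_pow B (n + 1) = 0" "Y ** mat_pow A (n + 1) = 0"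
    using XB YA by (simp_all add: mat_pow_Suc_left matrix_mul_assoc del: mat_pow.simps)
  moreover have "X ** mat_pow A (n + 1) = mat_pow A n" "Y ** mat_pow B (n + 1) = mat_pow B n"
    by (rule mat_drazin_index_equation[OF X] mat_drazin_index_equation[OF Y]; simp add: n_def)+
  ultimately have "(X + Y) ** mat_pow (A + B) (n + 1) = mat_pow (A + B) n"
    unfolding pow by (simp add: matrix_add_ldistrib matrix_mult_add_left del: mat_pow.simps)
  with 1 prod show ?thesis
    unfolding mat_drazin_def by metis
qed

section \<open>Passing to transformed frontal slices\<close>

lemma tslice_zero: "tslice M 0 i = 0"
  by (simp add: tslice_def frontal_slice_def mode3_prod_def vec_eq_iff)

lemma tslice_add: "tslice M (A + B) i = tslice M A i + tslice M B i"
  by (simp add: tslice_def frontal_slice_def mode3_prod_def vec_eq_iff distrib_right sum.distrib)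

lemma tslice_minus: "tslice M (- A) i = - tslice M A i"
  by (simp add: tslice_def frontal_slice_def mode3_prod_def vec_eq_iff sum_negf)

lemma tensor_eq_iff_tslice:
  assumes "invertible M"
  shows "A = B \<longleftrightarrow> (\<forall>i. tslice M A i = tslice M B i)"
  using ex1_tslice[OF assms, of "tslice M B"] by auto

lemma tslice_M_prod:
  assumes "invertible M"
  shows "tslice M (M_prod M A B) i = tslice M A i ** tslice M B i"
  using theI'[OF ex1_tslice[OF assms, of "\<lambda>k. tslice M A k ** tslice M B k"]]
  unfolding M_prod_def by blast

lemma tslice_M_id:
  assumes "invertible M"
  shows "tslice M (M_id M) i = mat 1"
  using theI'[OF ex1_tslice[OF assms, of "\<lambda>k. mat 1"]]
  unfolding M_id_def by blast

lemma tslice_M_pow: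
  assumes "invertible M"
  shows "tslice M (M_pow M A n) i = mat_pow (tslice M A i) n"
  using assms by (induction n) (simp_all add: tslice_M_id tslice_M_prod)

lemma mat_index_le_tubal_index: "mat_index (tslice M A i) \<le> tubal_index M A"
  unfolding tubal_index_def by (rule Max_ge) auto

lemma is_drazin_inverse_iff_tslice:
  assumes "invertible M"
  shows "is_drazin_inverse M A X \<longleftrightarrow> (\<forall>i. mat_drazin (tslice M A i) (tslice M X i))"
proof
  assume "is_drazin_inverse M A X"
  then show "\<forall>i. mat_drazin (tslice M A i) (tslice M X i)"
    unfolding is_drazin_inverse_def mat_drazin_def tensor_eq_iff_tslice[OF assms]
    by (simp only: tslice_M_prod[OF assms] tslice_M_pow[OF assms]) blast
next
  assume slices: "\<forall>i. mat_drazin (tslice M A i) (tslice M X i)"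
  then have "tslice M X i ** mat_pow (tslice M A i) (tubal_index M A + 1)
      = mat_pow (tslice M A i) (tubal_index M A)" for i
    using mat_drazin_index_equation mat_index_le_tubal_index by blast
  with slices show "is_drazin_inverse M A X"
    unfolding is_drazin_inverse_def mat_drazin_def tensor_eq_iff_tslice[OF assms]
    by (simp only: tslice_M_prod[OF assms] tslice_M_pow[OF assms]) blast
qed

text \<open>
  The slices of the inverse can be chosen independently of each other and assembled into a tensor, so
  existence and uniqueness carry over from matrices and the definite description is meaningful.
\<close>

lemma drazin_inverse_eq_iff:
  assumes "invertible M"
  shows "drazin_inverse M A = X \<longleftrightarrow> (\<forall>i. mat_drazin (tslice M A i) (tslice M X i))"
proof -
  obtain F where F: "\<And>i. mat_drazin (tslice M A i) (F i)"
    using mat_drazin_exists[of "tslice M A _"] by metis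
  obtain X0 where "\<And>i. tslice M X0 i = F i"
    using ex1_tslice[OF assms, of F] by blast
  then have "is_drazin_inverse M A X0"
    using F by (simp add: is_drazin_inverse_iff_tslice[OF assms])
  moreover have "X = Y" if "is_drazin_inverse M A X" "is_drazin_inverse M A Y" for X Y
    using that mat_drazin_unique
    unfolding is_drazin_inverse_iff_tslice[OF assms] tensor_eq_iff_tslice[OF assms, of X Y]
    by blast
  ultimately have "\<exists>!X. is_drazin_inverse M A X" by blast
  then have "drazin_inverse M A = X \<longleftrightarrow> is_drazin_inverse M A X"
    unfolding drazin_inverse_def by (metis the1_equality theI')
  then show ?thesis
    by (simp add: is_drazin_inverse_iff_tslice[OF assms])
qed

lemma drazin_inverse_minus:
  assumes "invertible M"
  shows "drazin_inverse M (- A) = - drazin_inverse M A"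
  using drazin_inverse_eq_iff[OF assms, of A "drazin_inverse M A"]
  by (simp add: drazin_inverse_eq_iff[OF assms] tslice_minus mat_drazin_minus)

lemma drazin_inverse_add:
  assumes "invertible M"
    and "\<And>i. tslice M A i ** tslice M B i = 0" and "\<And>i. tslice M B i ** tslice M A i = 0"
  shows "drazin_inverse M (A + B) = drazin_inverse M A + drazin_inverse M B"
  using drazin_inverse_eq_iff[OF assms(1), of A "drazin_inverse M A"]
    drazin_inverse_eq_iff[OF assms(1), of B "drazin_inverse M B"] assms(2,3)
  by (simp add: drazin_inverse_eq_iff[OF assms(1), of "A + B"] tslice_add mat_drazin_add)

theorem theorem3p13:
  fixes M :: "complex^'p^'p" and A B :: "complex^'p^'m^'m" and k1 k2 :: nat
  assumes "invertible M"
    and "tubal_index M A = k1" and "k1 \<ge> 1"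
    and "tubal_index M B = k2" and "k2 \<ge> 1"
    and "M_prod M A B = 0" and "M_prod M B A = 0"
  shows "drazin_inverse M (A + B) = drazin_inverse M A + drazin_inverse M B
    \<and> drazin_inverse M (A - B) = drazin_inverse M A - drazin_inverse M B"
proof
  have AB: "tslice M A i ** tslice M B i = 0" and BA: "tslice M B i ** tslice M A i = 0" for i
    using tslice_M_prod[OF assms(1), of A B i] tslice_M_prod[OF assms(1), of B A i] assms(6,7)
    by (simp_all add: tslice_zero)
  show "drazin_inverse M (A + B) = drazin_inverse M A + drazin_inverse M B"
    using assms(1) AB BA by (rule drazin_inverse_add)
  have "drazin_inverse M (A + (- B)) = drazin_inverse M A + drazin_inverse M (- B)"
    using assms(1)
    by (rule drazin_inverse_add)
      (simp_all add: tslice_minus matrix_mult_minus_left matrix_mult_minus_right AB BA)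
  then show "drazin_inverse M (A - B) = drazin_inverse M A - drazin_inverse M B"
    by (simp add: drazin_inverse_minus[OF assms(1)])
qed

end
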